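(* $\pi(\vec T_3,5/3)=1$.
   Context: A partially directed $3$-graph ($3$-PDG) on a vertex set $V$ specifies for each $3$-subset $S\subseteq V$ exactly one of: no edge on $S$; an undirected edge on $S$; or a directed edge on $S$ directed toward a chosen vertex of $S$. For an $n$-vertex $3$-PDG $\vec H$, $\alpha(\vec H)=e_u(\vec H)/\binom n3$ and $\beta(\vec H)=e_d(\vec H)/\binom n3$, with $e_u,e_d$ the numbers of undirected and directed edges. $\vec F$ is a subgraph of $\vec H$ if a $3$-PDG isomorphic to $\vec F$ can be obtained from $\vec H$ by deleting edges, deleting vertices and forgetting directions of edges; $\vec H$ is $\vec F$-free otherwise. $\vec T_3$ is the $3$-PDG on $\{1,2,3,4\}$ with undirected edges $\{1,2,3\}$, $\{2,3,4\}$ and the edge $\{1,2,4\}$ directed toward $4$. $\pi(\vec F,\theta)$ is the smallest real number such that every $n$-vertex $\vec F$-free $3$-PDG $\vec H$ satisfies $\alpha(\vec H)+\theta\beta(\vec H)\le\pi(\vec F,\theta)+o_{n\to\infty}(1)$. *)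

theory Defs
  imports Complex_Main
begin

datatype 'a edge_status = NoEdge | Undirected | Directed 'a

text \<open>
  The field \<open>status\<close> is only meaningful on the 3-subsets of \<open>verts\<close>; its values on all other
  sets are ignored by every notion below.
\<close>

record 'a pdg3 =
  verts :: "'a set"
  status :: "'a set \<Rightarrow> 'a edge_status"

definition triples :: "'a pdg3 \<Rightarrow> 'a set set" where
  "triples H = {S. S \<subseteq> verts H \<and> card S = 3}"

definition is_pdg3 :: "'a pdg3 \<Rightarrow> bool" where
  "is_pdg3 H \<longleftrightarrow> finite (verts H) \<and> (\<forall>S\<in>triples H. \<forall>v. status H S = Directed v \<longrightarrow> v \<in> S)"

definition undirected_edges :: "'a pdg3 \<Rightarrow> 'a set set" where
  "undirected_edges H = {S \<in> triples H. status H S = Undirected}"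

definition directed_edges :: "'a pdg3 \<Rightarrow> 'a set set" where
  "directed_edges H = {S \<in> triples H. \<exists>v. status H S = Directed v}"

definition undirected_density :: "'a pdg3 \<Rightarrow> real" where
  "undirected_density H = real (card (undirected_edges H)) / real (card (verts H) choose 3)"

definition directed_density :: "'a pdg3 \<Rightarrow> real" where
  "directed_density H = real (card (directed_edges H)) / real (card (verts H) choose 3)"

definition pdg3_iso :: "'a pdg3 \<Rightarrow> 'b pdg3 \<Rightarrow> bool" where
  "pdg3_iso F G \<longleftrightarrow>
     (\<exists>f. bij_betw f (verts F) (verts G) \<and>
          (\<forall>S\<in>triples F. status G (f ` S) = map_edge_status f (status F S)))"

definition delete_vertices :: "'a set \<Rightarrow> 'a pdg3 \<Rightarrow> 'a pdg3" where
  "delete_vertices X H = H\<lparr>verts := verts H - X\<rparr>"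

definition delete_edges :: "'a set set \<Rightarrow> 'a pdg3 \<Rightarrow> 'a pdg3" where
  "delete_edges A H = H\<lparr>status := (\<lambda>S. if S \<in> A then NoEdge else status H S)\<rparr>"

definition forget_directions :: "'a set set \<Rightarrow> 'a pdg3 \<Rightarrow> 'a pdg3" where
  "forget_directions B H =
     H\<lparr>status := (\<lambda>S. case status H S of
         Directed v \<Rightarrow> (if S \<in> B then Undirected else Directed v)
       | s \<Rightarrow> s)\<rparr>"

text \<open>
  Any sequence of deletions and forgettings, in any order, can be rearranged into the order used here.
\<close>

definition pdg3_subgraph :: "'a pdg3 \<Rightarrow> 'b pdg3 \<Rightarrow> bool" where
  "pdg3_subgraph F H \<longleftrightarrow>
     (\<exists>X A B. pdg3_iso F (forget_directions B (delete_edges A (delete_vertices X H))))"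

definition pdg3_free :: "'a pdg3 \<Rightarrow> 'b pdg3 \<Rightarrow> bool" where
  "pdg3_free F H \<longleftrightarrow> \<not> pdg3_subgraph F H"

text \<open>
  The function \<open>\<epsilon>\<close> is the error term $o_{n\to\infty}(1)$, uniform over all $n$-vertex hosts. Hosts
  with vertices of type \<^typ>\<open>nat\<close> represent every isomorphism class of finite 3-PDGs.
\<close>

definition asymptotic_bound :: "'a pdg3 \<Rightarrow> real \<Rightarrow> real \<Rightarrow> bool" where
  "asymptotic_bound F \<theta> c \<longleftrightarrow>
     (\<exists>\<epsilon> :: nat \<Rightarrow> real. \<epsilon> \<longlonglongrightarrow> 0 \<and>
        (\<forall>n. \<forall>H :: nat pdg3. is_pdg3 H \<and> card (verts H) = n \<and> pdg3_free F H \<longrightarrow>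
           undirected_density H + \<theta> * directed_density H \<le> c + \<epsilon> n))"

definition turan_density :: "'a pdg3 \<Rightarrow> real \<Rightarrow> real" where
  "turan_density F \<theta> = (LEAST c. asymptotic_bound F \<theta> c)"

definition T3 :: "nat pdg3" where
  "T3 = \<lparr>verts = {1, 2, 3, 4},
         status = (\<lambda>S. if S = {1, 2, 3} \<or> S = {2, 3, 4} then Undirected
                       else if S = {1, 2, 4} then Directed 4
                       else NoEdge)\<rparr>"

lemma is_pdg3_T3: "is_pdg3 T3"
  by (auto simp: is_pdg3_def T3_def split: if_splits)

end

theory Submission
  imports Defs
begin

text \<open>
  A 3-PDG is \<open>T3\<close>-free iff, in the link graph of every vertex \<open>v\<close>, no pair that forms with \<open>v\<close> an
  edge directed away from \<open>v\<close> lies in a triangle. A graph on \<open>m\<close> vertices with a set \<open>D\<close> of edges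
  lying in no triangle satisfies \<open>|E| + |D| \<le> m\<^sup>2 / 2\<close>. Summed over all links, every undirected edge
  is counted 3 times and every directed edge 3 + 2 = 5 times, whence the weight 5/3. The complete
  undirected 3-graph shows that the bound is attained.
\<close>

section \<open>Graphs with edges outside all triangles\<close>

text \<open>Induction on the number of vertices, deleting both ends of an edge \<open>{u, v}\<close>
  of \<open>D\<close>. No vertex is adjacent to both ends, so with m vertices left at most m + 1
  edges of \<open>E\<close> disappear, and at most m + 1 of \<open>D\<close>. The step closes
  because m^2 + 4(m + 1) = (m + 2)^2. If \<open>D\<close> is empty, the trivial bound on
  \<open>E\<close> is enough.\<close>

lemma card_edges_plus_triangle_free_edges:
  assumes "finite V"
    and "E \<subseteq> {P. P \<subseteq> V \<and> card P = 2}"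
    and "D \<subseteq> E"
    and "\<And>a b x. \<lbrakk>{a, b} \<in> D; {a, x} \<in> E; x \<noteq> b\<rbrakk> \<Longrightarrow> {b, x} \<notin> E"
  shows "2 * (card E + card D) \<le> (card V)\<^sup>2"
  using assms
proof (induction "card V" arbitrary: V E D rule: less_induct)
  case less
  note E_sub = less.prems(2) and D_sub = less.prems(3) and tri = less.prems(4)
  let ?n = "card V"
  have fin_pairs: "finite {P. P \<subseteq> V \<and> card P = 2}"
    using less.prems(1) by (auto intro: finite_subset[of _ "Pow V"])
  have finE: "finite E"
    using E_sub fin_pairs by (rule finite_subset)
  have finD: "finite D"
    using D_sub finE by (rule finite_subset)
  show ?case
  proof (cases "D = {}")
    case True
    have "card E \<le> ?n choose 2"
      using card_mono[OF fin_pairs E_sub] n_subsets[OF less.prems(1), of 2] by simp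
    then have "2 * card E \<le> 2 * (?n * (?n - 1) div 2)"
      by (simp add: choose_two)
    also have "\<dots> \<le> ?n * (?n - 1)"
      by simp
    also have "\<dots> \<le> ?n\<^sup>2"
      by (simp add: power2_eq_square)
    finally show ?thesis
      using True by simp
  next
    case False
    then obtain e where "e \<in> D" by blast
    moreover from this obtain u v where "e = {u, v}" "u \<noteq> v"
      using D_sub E_sub by (auto simp: card_2_iff)
    ultimately have uv: "{u, v} \<in> D" "u \<noteq> v" by auto
    with D_sub E_sub have uvV: "{u, v} \<subseteq> V" by auto
    let ?W = "V - {u, v}"
    let ?E' = "{P \<in> E. P \<subseteq> ?W}" and ?D' = "{P \<in> D. P \<subseteq> ?W}"
    have cardW: "?n = card ?W + 2"
    proof -
      have "card ?W = ?n - 2" and "2 \<le> ?n"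
        using uv uvV less.prems(1) card_mono[of V "{u, v}"] by (auto simp: card_Diff_subset)
      then show ?thesis by simp
    qed
    have IH: "2 * (card ?E' + card ?D') \<le> (card ?W)\<^sup>2"
    proof (rule less.hyps)
      show "card ?W < ?n" using cardW by simp
      show "finite ?W" using less.prems(1) by simp
      show "?E' \<subseteq> {P. P \<subseteq> ?W \<and> card P = 2}" using E_sub by auto
      show "?D' \<subseteq> ?E'" using D_sub by auto
      show "{b, x} \<notin> ?E'" if "{a, b} \<in> ?D'" "{a, x} \<in> ?E'" "x \<noteq> b" for a b x
        using that tri[of a b x] by simp
    qed
    \<comment> \<open>Each vertex other than \<open>u\<close> and \<open>v\<close> is adjacent to at most one of them.\<close>
    let ?f = "\<lambda>x. if {u, x} \<in> E then {u, x} else {v, x}"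
    have sub: "E - ?E' \<subseteq> insert {u, v} (?f ` ?W)"
    proof
      fix P assume P: "P \<in> E - ?E'"
      then obtain p q where pq: "P = {p, q}" "p \<noteq> q" "p \<in> {u, v}" "q \<in> V"
        using E_sub by (auto simp: card_2_iff doubleton_eq_iff; blast)
      show "P \<in> insert {u, v} (?f ` ?W)"
      proof (cases "q \<in> {u, v}")
        case True
        then show ?thesis using pq by auto
      next
        case False
        then have "P = ?f q"
          using P pq uv tri[of u v q] by auto
        then show ?thesis using False pq by blast
      qed
    qed
    have fW: "finite ?W" using less.prems(1) by simp
    have "card (E - ?E') \<le> card (insert {u, v} (?f ` ?W))"
      using sub fW by (intro card_mono) auto
    also have "\<dots> \<le> Suc (card ?W)"
      using card_image_le[OF fW, of ?f] fW by (simp only: card_insert_if finite_imageI) auto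
    finally have E_le: "card (E - ?E') \<le> Suc (card ?W)" .
    \<comment> \<open>A deleted edge of \<open>D\<close> is also a deleted edge of \<open>E\<close>,
      so the same bound serves for both.\<close>
    have "card (D - ?D') \<le> card (E - ?E')"
      using D_sub finE by (intro card_mono) auto
    with E_le have D_le: "card (D - ?D') \<le> Suc (card ?W)" by simp
    have "card E = card ?E' + card (E - ?E')"
      using finE by (subst card_Un_disjoint[symmetric]) (auto intro: arg_cong[where f = card])
    moreover have "card D = card ?D' + card (D - ?D')"
      using finD by (subst card_Un_disjoint[symmetric]) (auto intro: arg_cong[where f = card])
    ultimately have "2 * (card E + card D) =
        2 * (card ?E' + card ?D') + 2 * (card (E - ?E') + card (D - ?D'))"
      by (simp only: distrib_left ac_simps)
    also have "\<dots> \<le> (card ?W)\<^sup>2 + 2 * (Suc (card ?W) + Suc (card ?W))"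
      by (intro add_mono mult_le_mono order_refl IH E_le D_le)
    also have "\<dots> = ?n\<^sup>2"
      unfolding cardW by (simp add: power2_eq_square algebra_simps)
    finally show ?thesis .
  qed
qed

section \<open>Copies of \<open>T3\<close>\<close>

lemma triples_T3: "triples T3 = {{1, 2, 3}, {2, 3, 4}, {1, 2, 4}, {1, 3, 4}}"
proof
  show "triples T3 \<subseteq> {{1, 2, 3}, {2, 3, 4}, {1, 2, 4}, {1, 3, 4}}"
  proof
    fix S assume "S \<in> triples T3"
    then have S: "S \<subseteq> {1, 2, 3, 4}" "card S = 3"
      by (auto simp: triples_def T3_def)
    then have "card ({1, 2, 3, 4} - S) = 1"
      by (subst card_Diff_subset) (auto intro: finite_subset)
    then obtain x where x: "{1, 2, 3, 4} - S = {x}"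
      by (rule card_1_singletonE)
    have "S = {1, 2, 3, 4} - ({1, 2, 3, 4} - S)"
      using S(1) by (rule double_diff[OF _ subset_refl, symmetric])
    then have "S = {1, 2, 3, 4} - {x}"
      unfolding x .
    moreover have "x \<in> {1, 2, 3, 4}"
      using x by (metis Diff_iff insertI1)
    ultimately show "S \<in> {{1, 2, 3}, {2, 3, 4}, {1, 2, 4}, {1, 3, 4}}"
      by (elim insertE emptyE) (simp_all add: insert_Diff_if insert_commute)
  qed
qed (auto simp: triples_def T3_def)

text \<open>Vertex 2 lies on all three edges of \<open>T3\<close>, whose pairs in its link form a
  triangle, one of them coming from an edge directed away from 2. Here \<open>b\<close> plays that
  role: in its link, the pair \<open>{a, c}\<close> cannot be completed to a triangle by
  \<open>d\<close>.\<close>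

lemma T3_free_no_copy:
  assumes free: "pdg3_free T3 H"
    and V: "{a, b, c, d} \<subseteq> verts H"
    and dist: "distinct [a, b, c, d]"
    and abc: "status H {a, b, c} = Directed c"
    and abd: "status H {a, b, d} \<noteq> NoEdge"
  shows "status H {b, c, d} = NoEdge"
proof (rule ccontr)
  assume bcd: "status H {b, c, d} \<noteq> NoEdge"
  \<comment> \<open>The vertices 1, 2, 3, 4 go to \<open>a\<close>, \<open>b\<close>,
    \<open>d\<close>, \<open>c\<close>, so that the head 4 lands on the head
    \<open>c\<close>.\<close>
  define f :: "nat \<Rightarrow> 'a" where
    "f = (\<lambda>i. if i = 1 then a else if i = 2 then b else if i = 3 then d else c)"
  \<comment> \<open>The two edges through \<open>b\<close> and \<open>d\<close> may be directed in
    \<open>H\<close>, so their directions are forgotten; \<open>{a, c, d}\<close> is cleared because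
    \<open>T3\<close> has no edge on \<open>{1, 3, 4}\<close>.\<close>
  define G where "G = forget_directions {{a, b, d}, {b, c, d}}
    (delete_edges {{a, c, d}} (delete_vertices (- {a, b, c, d}) H))"
  have vG: "verts G = {a, b, c, d}"
    using V by (auto simp: G_def forget_directions_def delete_edges_def delete_vertices_def)
  have sG: "status G S = (if S = {a, c, d} then NoEdge else case status H S of
      Directed v \<Rightarrow> (if S \<in> {{a, b, d}, {b, c, d}} then Undirected else Directed v) | s \<Rightarrow> s)" for S
    by (simp add: G_def forget_directions_def delete_edges_def delete_vertices_def)
  have im: "f ` {1, 2, 3} = {a, b, d}" "f ` {2, 3, 4} = {b, c, d}"
    "f ` {1, 2, 4} = {a, b, c}" "f ` {1, 3, 4} = {a, c, d}"
    by (auto simp: f_def)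
  have neq: "{a, b, d} \<noteq> {a, c, d}" "{b, c, d} \<noteq> {a, c, d}" "{a, b, c} \<noteq> {a, c, d}"
    "{a, b, c} \<noteq> {a, b, d}" "{a, b, c} \<noteq> {b, c, d}"
    using dist by auto
  have sG': "status G {a, b, d} = Undirected" "status G {b, c, d} = Undirected"
    "status G {a, b, c} = Directed c" "status G {a, c, d} = NoEdge"
    using neq abc abd bcd by (simp_all add: sG split: edge_status.split)
  have neqT: "{1, 2, 4} \<noteq> {1, 2, 3 :: nat}" "{1, 2, 4} \<noteq> {2, 3, 4 :: nat}"
    "{1, 3, 4} \<noteq> {1, 2, 3 :: nat}" "{1, 3, 4} \<noteq> {2, 3, 4 :: nat}" "{1, 3, 4} \<noteq> {1, 2, 4 :: nat}"
    by (simp_all add: set_eq_iff) presburger+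
  have sT: "status T3 {1, 2, 3} = Undirected" "status T3 {2, 3, 4} = Undirected"
    "status T3 {1, 2, 4} = Directed 4" "status T3 {1, 3, 4} = NoEdge"
    using neqT by (simp_all only: T3_def pdg3.simps if_True if_False simp_thms)
  have "bij_betw f (verts T3) (verts G)"
    using dist by (auto simp: bij_betw_def inj_on_def vG T3_def f_def)
  moreover have "status G (f ` S) = map_edge_status f (status T3 S)" if "S \<in> triples T3" for S
  proof -
    have "f 4 = c" by (simp add: f_def)
    with that show ?thesis
      unfolding triples_T3 by (elim insertE emptyE; simp only: im sT sG' edge_status.map)
  qed
  ultimately have "pdg3_iso T3 G"
    unfolding pdg3_iso_def by blast
  with free show False
    unfolding pdg3_free_def pdg3_subgraph_def G_def by blast
qed

text \<open>Deleting and forgetting never create a direction, so nothing can match the directed edge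
  \<open>{1, 2, 4}\<close>.\<close>

lemma T3_free_if_no_directed_edge:
  assumes "\<And>S v. status H S \<noteq> Directed v"
  shows "pdg3_free T3 H"
  unfolding pdg3_free_def pdg3_subgraph_def
proof
  assume "\<exists>X A B. pdg3_iso T3 (forget_directions B (delete_edges A (delete_vertices X H)))"
  then obtain X A B f where iso:
    "\<forall>S\<in>triples T3. status (forget_directions B (delete_edges A (delete_vertices X H))) (f ` S)
       = map_edge_status f (status T3 S)"
    unfolding pdg3_iso_def by blast
  have T: "{1, 2, 4} \<in> triples T3"
    by (simp add: triples_T3)
  have "status T3 {1, 2, 4} = Directed 4"
    by (auto simp: T3_def)
  then have "status (forget_directions B (delete_edges A (delete_vertices X H))) (f ` {1, 2, 4})
       = Directed (f 4)"
    using bspec[OF iso T] by (simp only: edge_status.map)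
  with assms show False
    by (auto simp: forget_directions_def delete_edges_def delete_vertices_def
        split: edge_status.splits if_splits)
qed

section \<open>Summation over links\<close>

lemma card_link_eq:
  assumes "v \<in> V"
  shows "card {P. P \<subseteq> V - {v} \<and> card P = 2 \<and> Q (insert v P)} =
    card {S. S \<subseteq> V \<and> card S = 3 \<and> v \<in> S \<and> Q S}"
proof (rule bij_betw_same_card[of "insert v"], rule bij_betw_byWitness[where f' = "\<lambda>S. S - {v}"])
  show "insert v ` {P. P \<subseteq> V - {v} \<and> card P = 2 \<and> Q (insert v P)} \<subseteq>
      {S. S \<subseteq> V \<and> card S = 3 \<and> v \<in> S \<and> Q S}"
  proof clarify
    fix P assume P: "P \<subseteq> V - {v}" "card P = 2" "Q (insert v P)"
    then have "finite P" "v \<notin> P"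
      using card.infinite by fastforce+
    then show "insert v P \<subseteq> V \<and> card (insert v P) = 3 \<and> v \<in> insert v P \<and> Q (insert v P)"
      using assms P by auto
  qed
  show "(\<lambda>S. S - {v}) ` {S. S \<subseteq> V \<and> card S = 3 \<and> v \<in> S \<and> Q S} \<subseteq>
      {P. P \<subseteq> V - {v} \<and> card P = 2 \<and> Q (insert v P)}"
    by (auto simp: insert_absorb)
qed auto

text \<open>Double counting of the incident pairs (v, S) that satisfy \<open>Q S v\<close>.\<close>

lemma sum_card_incident:
  assumes "finite V" "finite A" "\<And>S. S \<in> A \<Longrightarrow> S \<subseteq> V"
  shows "(\<Sum>v\<in>V. card {S \<in> A. v \<in> S \<and> Q S v}) = (\<Sum>S\<in>A. card {v \<in> S. Q S v})"
proof -
  have "(\<Sum>v\<in>V. card {S \<in> A. v \<in> S \<and> Q S v}) = (\<Sum>v\<in>V. \<Sum>S\<in>{S \<in> A. v \<in> S \<and> Q S v}. 1)"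
    by simp
  also have "\<dots> = (\<Sum>S\<in>A. \<Sum>v\<in>{v \<in> V. v \<in> S \<and> Q S v}. 1)"
    using assms by (intro sum.swap_restrict) auto
  also have "\<dots> = (\<Sum>S\<in>A. card {v \<in> S. Q S v})"
  proof (rule sum.cong[OF refl])
    fix S assume "S \<in> A"
    then have "{v \<in> V. v \<in> S \<and> Q S v} = {v \<in> S. Q S v}" using assms by blast
    then show "(\<Sum>v\<in>{v \<in> V. v \<in> S \<and> Q S v}. 1) = card {v \<in> S. Q S v}" by simp
  qed
  finally show ?thesis .
qed

lemma T3_free_edge_bound:
  assumes H: "is_pdg3 H" and free: "pdg3_free T3 H"
  shows "2 * (3 * card (undirected_edges H) + 5 * card (directed_edges H))
    \<le> card (verts H) * (card (verts H) - 1)\<^sup>2"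
proof -
  let ?V = "verts H"
  let ?E = "\<lambda>S. status H S \<noteq> NoEdge"
  let ?out = "\<lambda>v S. \<exists>w. w \<noteq> v \<and> status H S = Directed w"
  have fV: "finite ?V" using H by (simp add: is_pdg3_def)
  have fT: "finite (triples H)"
    unfolding triples_def using fV by (auto intro: finite_subset[of _ "Pow ?V"])
  have T_sub: "S \<subseteq> ?V" if "S \<in> triples H" for S
    using that by (simp add: triples_def)
  have link: "2 * (card {S \<in> triples H. v \<in> S \<and> ?E S} + card {S \<in> triples H. v \<in> S \<and> ?out v S})
      \<le> (card ?V - 1)\<^sup>2" if v: "v \<in> ?V" for v
  proof -
    let ?L = "{P. P \<subseteq> ?V - {v} \<and> card P = 2 \<and> ?E (insert v P)}"
    let ?D = "{P. P \<subseteq> ?V - {v} \<and> card P = 2 \<and> ?out v (insert v P)}"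
    have "2 * (card ?L + card ?D) \<le> (card (?V - {v}))\<^sup>2"
    proof (rule card_edges_plus_triangle_free_edges)
      fix a b x
      assume ab: "{a, b} \<in> ?D" and ax: "{a, x} \<in> ?L" and "x \<noteq> b"
      then have dist: "distinct [a, v, b, x]" and V: "{a, v, b, x} \<subseteq> ?V"
        using v by (auto simp: card_insert_if split: if_splits)
      from ab obtain w where w: "w \<noteq> v" "status H {v, a, b} = Directed w" by auto
      have "{v, a, b} \<in> triples H"
        using dist V by (auto simp: triples_def)
      \<comment> \<open>The head lies in the triple and differs from \<open>v\<close>, so it is one
        of the other two vertices.\<close>
      with H w have "w = a \<or> w = b" by (auto simp: is_pdg3_def)
      then show "{b, x} \<notin> ?L"
      proof
        assume "w = b"
        then have "status H {v, b, x} = NoEdge"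
          using T3_free_no_copy[OF free V] dist w ax by (simp add: insert_commute)
        then show ?thesis by simp
      next
        assume "w = a"
        moreover have "{b, v, a, x} \<subseteq> ?V" "distinct [b, v, a, x]" using V dist by auto
        \<comment> \<open>With the head at \<open>a\<close> the excluded configuration is used in
          contrapositive form: an edge on \<open>{b, v, x}\<close> would rule out the edge on
          \<open>{v, a, x}\<close>, which is present by \<open>ax\<close>.\<close>
        ultimately have "status H {b, v, x} = NoEdge"
          using T3_free_no_copy[OF free, of b v a x] w ax by (auto simp: insert_commute)
        then show ?thesis by (simp add: insert_commute)
      qed
    qed (use fV in auto)
    then show ?thesis
      using card_link_eq[OF v, of ?E] card_link_eq[OF v, of "?out v"] v fV
      by (simp add: triples_def conj_ac)
  qed
  \<comment> \<open>A directed edge is seen in the links of its three vertices, and as pointing away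
    by the two vertices other than its head.\<close>
  have weight: "card {v \<in> S. ?E S} + card {v \<in> S. ?out v S} =
      (if status H S = Undirected then 3 else 0) + (if \<exists>w. status H S = Directed w then 5 else 0)"
    if S: "S \<in> triples H" for S
  proof (cases "status H S")
    case (Directed w)
    then have "w \<in> S" using H S by (simp add: is_pdg3_def)
    moreover have "{v \<in> S. ?out v S} = S - {w}" using Directed by auto
    ultimately show ?thesis using Directed S by (simp add: triples_def)
  qed (use S in \<open>simp_all add: triples_def\<close>)
  have "2 * (3 * card (undirected_edges H) + 5 * card (directed_edges H)) =
      2 * (\<Sum>S\<in>triples H. card {v \<in> S. ?E S} + card {v \<in> S. ?out v S})"
    using fT by (simp add: weight sum.distrib undirected_edges_def directed_edges_def
        flip: sum.inter_filter)
  also have "\<dots> = (\<Sum>v\<in>?V. 2 * (card {S \<in> triples H. v \<in> S \<and> ?E S}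
      + card {S \<in> triples H. v \<in> S \<and> ?out v S}))"
    using sum_card_incident[OF fV fT T_sub, of "\<lambda>S v. ?E S"]
      sum_card_incident[OF fV fT T_sub, of "\<lambda>S v. ?out v S"]
    by (simp add: sum.distrib flip: sum_distrib_left)
  also have "\<dots> \<le> (\<Sum>v\<in>?V. (card ?V - 1)\<^sup>2)"
    using link by (rule sum_mono)
  finally show ?thesis by simp
qed

section \<open>The Turan density\<close>

text \<open>Subtraction is taken in the reals; for n < 3 one of the factors vanishes, so no side
  condition arises.\<close>

lemma real_choose_three: "real (n choose 3) = real n * (real n - 1) * (real n - 2) / 6"
  by (simp add: binomial_gbinomial gbinomial_prod_rev numeral_3_eq_3 lessThan_Suc algebra_simps)

lemma asymptotic_bound_T3: "asymptotic_bound T3 (5 / 3) 1"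
  unfolding asymptotic_bound_def
proof (intro exI conjI allI impI)
  \<comment> \<open>Dividing n(n - 1)^2 / 6 by the binomial coefficient leaves (n - 1)/(n - 2) = 1 +
    1/(n - 2), which dictates the error term.\<close>
  show "(\<lambda>n. 1 / (real n - 2)) \<longlonglongrightarrow> 0"
    by (rule LIMSEQ_offset[of _ 2]) (simp add: lim_1_over_n)
  fix n and H :: "nat pdg3"
  assume H: "is_pdg3 H \<and> card (verts H) = n \<and> pdg3_free T3 H"
  show "undirected_density H + 5 / 3 * directed_density H \<le> 1 + 1 / (real n - 2)"
  proof (cases "n < 3")
    \<comment> \<open>Division by zero yields 0: both densities vanish, and the right-hand side is
      1/2, 0, 1 for n = 0, 1, 2.\<close>
    case True
    then have "undirected_density H = 0" "directed_density H = 0"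
      using H by (simp_all add: undirected_density_def directed_density_def binomial_eq_0)
    moreover have "n = 0 \<or> n = 1 \<or> n = 2"
      using True by auto
    ultimately show ?thesis by auto
  next
    case False
    then have n: "real n \<ge> 3" by simp
    let ?u = "real (card (undirected_edges H))" and ?d = "real (card (directed_edges H))"
    have "real (2 * (3 * card (undirected_edges H) + 5 * card (directed_edges H)))
        \<le> real (n * (n - 1)\<^sup>2)"
      using T3_free_edge_bound[of H] H by (intro of_nat_mono) auto
    then have "2 * (3 * ?u + 5 * ?d) \<le> real n * (real n - 1)\<^sup>2"
      using False by (simp add: of_nat_diff)
    then have "?u + 5 / 3 * ?d \<le> real n * (real n - 1)\<^sup>2 / 6" by simp
    also have "\<dots> = (1 + 1 / (real n - 2)) * real (n choose 3)"
      using n unfolding real_choose_three by (simp add: field_simps power2_eq_square)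
    finally have "(?u + 5 / 3 * ?d) / real (n choose 3) \<le> 1 + 1 / (real n - 2)"
      using False by (simp add: pos_divide_le_eq)
    then show ?thesis
      using H by (simp add: undirected_density_def directed_density_def add_divide_distrib)
  qed
qed

text \<open>Complete undirected 3-graphs have undirected density 1 and no directed edges, so they
  force the bound for every \<theta>.\<close>

lemma asymptotic_bound_T3_ge_1:
  assumes "asymptotic_bound T3 \<theta> c"
  shows "1 \<le> c"
proof -
  obtain \<epsilon> :: "nat \<Rightarrow> real" where lim: "\<epsilon> \<longlonglongrightarrow> 0" and
    bound: "\<And>n (H :: nat pdg3). \<lbrakk>is_pdg3 H; card (verts H) = n; pdg3_free T3 H\<rbrakk> \<Longrightarrow>
      undirected_density H + \<theta> * directed_density H \<le> c + \<epsilon> n"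
    using assms unfolding asymptotic_bound_def by blast
  have "1 \<le> c + \<epsilon> n" if n: "n \<ge> 3" for n
  proof -
    let ?K = "\<lparr>verts = {..<n}, status = (\<lambda>_. Undirected)\<rparr>"
    have "undirected_density ?K = 1" "directed_density ?K = 0"
      using n n_subsets[of "{..<n}" 3]
      by (simp_all add: undirected_density_def directed_density_def undirected_edges_def
          directed_edges_def triples_def)
    moreover have "undirected_density ?K + \<theta> * directed_density ?K \<le> c + \<epsilon> n"
      by (rule bound) (auto simp: is_pdg3_def intro: T3_free_if_no_directed_edge)
    ultimately show ?thesis by simp
  qed
  then have "1 \<le> c + 0"
    by (intro LIMSEQ_le_const[OF tendsto_add[OF tendsto_const lim]]) blast
  then show ?thesis by simp
qed

theorem theorem2p3: "turan_density T3 (5 / 3) = 1"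
  \<comment> \<open>Over the reals \<open>LEAST\<close> is informative only when a minimum exists: 1
    is itself a bound and lies below all others.\<close>
  unfolding turan_density_def
  using asymptotic_bound_T3 asymptotic_bound_T3_ge_1 by (rule Least_equality)

end
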